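(* Let $\alpha,\beta,a,b,c,d,e\ge 0$ be real numbers with $a+b=1$, $\alpha+\beta=1$, $c+d+e=1$, let $V:S^2\to S^2$ be the operator $V(x_1,x_2,x_3)=(x_1',x_2',x_3')$ given by $$x_1'=\alpha x_2^2+cx_3^2+2x_2x_3,\qquad x_2'=ax_1^2+dx_3^2+2x_1x_3,\qquad x_3'=bx_1^2+\beta x_2^2+ex_3^2+2x_1x_2,$$ and let $x^*=(x_1^*,x_2^*,x_3^* )\in S^2$ be a fixed point of $V$. Then the eigenvalues of the Jacobian of $V$ at $x^*$ (in the coordinates $(x_1,x_2)$) are $\lambda_{1,2}=ex_3^*-1\pm\sqrt{D}$, where $$D=(ex_3^*-1)^2+4e(x_3^* )^2+4\big[(b\beta-1)x_1^*x_2^*+(a(1-c)-1)x_1^*x_3^*+(\alpha(1-d)-1)x_2^*x_3^*\big],$$ and the type of $x^*$ is as follows: - if $D<-1+(1-ex_3^* )^2$, then $x^*$ is repelling; - if $D=-1+(1-ex_3^* )^2$, then $x^*$ is nonhyperbolic; - if $-1+(1-ex_3^* )^2<D<0$, then $x^*$ is attracting; - if $D=0$ and $ex_3^*=0$, then $x^*$ is nonhyperbolic; - if $D=0$ and $ex_3^*>0$, then $x^*$ is attracting; - if $0<D<e^2(x_3^* )^2$, then $x^*$ is attracting; - if $D=e^2(x_3^* )^2$, then $x^*$ is nonhyperbolic; - if $e^2(x_3^* )^2<D<(2-ex_3^* )^2$, then $x^*$ is a saddle point; - if $D=(2-ex_3^* )^2$, then $x^*$ is nonhyperbolic; - if $(2-ex_3^*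 )^2<D$, then $x^*$ is repelling.
   Context: $S^2=\{(x_1,x_2,x_3)\in\mathbb{R}^3: x_i\ge 0,\ x_1+x_2+x_3=1\}$. The Jacobian of $V$ at a fixed point is taken after substituting $x_3=1-x_1-x_2$, i.e. it is the $2\times2$ Jacobian matrix at $(x_1^*,x_2^* )$ of the map $(x_1,x_2)\mapsto(x_1',x_2')$. If $D<0$, $\sqrt D$ denotes $i\sqrt{|D|}$. A fixed point is hyperbolic if its Jacobian has no eigenvalue of absolute value $1$, and nonhyperbolic otherwise. A hyperbolic fixed point is attracting if all eigenvalues of the Jacobian have absolute value less than $1$, repelling if all have absolute value greater than $1$, and a saddle otherwise. *)

theory Defs
  imports "HOL-Analysis.Analysis"
begin

definition simplex2 :: "(real^3) set" where
  "simplex2 = {x. (\<forall>i. 0 \<le> x $ i) \<and> x $ 1 + x $ 2 + x $ 3 = 1}"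

definition V :: "real \<Rightarrow> real \<Rightarrow> real \<Rightarrow> real \<Rightarrow> real \<Rightarrow> real \<Rightarrow> real \<Rightarrow> real^3 \<Rightarrow> real^3" where
  "V \<alpha> \<beta> a b c d e x = vector
     [\<alpha> * (x $ 2)\<^sup>2 + c * (x $ 3)\<^sup>2 + 2 * x $ 2 * x $ 3,
      a * (x $ 1)\<^sup>2 + d * (x $ 3)\<^sup>2 + 2 * x $ 1 * x $ 3,
      b * (x $ 1)\<^sup>2 + \<beta> * (x $ 2)\<^sup>2 + e * (x $ 3)\<^sup>2 + 2 * x $ 1 * x $ 2]"

lemma V_maps_simplex:
  assumes "\<alpha> \<ge> 0" "\<beta> \<ge> 0" "a \<ge> 0" "b \<ge> 0" "c \<ge> 0" "d \<ge> 0" "e \<ge> 0"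
    and "a + b = 1" "\<alpha> + \<beta> = 1" "c + d + e = 1"
  shows "V \<alpha> \<beta> a b c d e \<in> simplex2 \<rightarrow> simplex2"
proof
  fix x assume "x \<in> simplex2"
  then have nn: "x $ 1 \<ge> 0" "x $ 2 \<ge> 0" "x $ 3 \<ge> 0" and s: "x $ 1 + x $ 2 + x $ 3 = 1"
    by (auto simp: simplex2_def)
  have "V \<alpha> \<beta> a b c d e x $ 1 + V \<alpha> \<beta> a b c d e x $ 2 + V \<alpha> \<beta> a b c d e x $ 3
      = (a + b) * (x $ 1)\<^sup>2 + (\<alpha> + \<beta>) * (x $ 2)\<^sup>2 + (c + d + e) * (x $ 3)\<^sup>2
        + 2 * x $ 2 * x $ 3 + 2 * x $ 1 * x $ 3 + 2 * x $ 1 * x $ 2"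
    by (simp add: V_def algebra_simps)
  also have "\<dots> = (x $ 1 + x $ 2 + x $ 3)\<^sup>2"
    using assms(8-10) by (simp add: power2_eq_square algebra_simps)
  finally show "V \<alpha> \<beta> a b c d e x \<in> simplex2"
    using nn s assms(1-7) by (simp add: simplex2_def forall_3 V_def)
qed

text \<open>The map in the coordinates \<open>(x\<^sub>1, x\<^sub>2)\<close>, with \<open>x\<^sub>3 = 1 - x\<^sub>1 - x\<^sub>2\<close>. It is defined on the
  whole plane, so that the Jacobian makes sense at boundary points of the simplex as well.\<close>

definition planar_map :: "(real^3 \<Rightarrow> real^3) \<Rightarrow> real^2 \<Rightarrow> real^2" where
  "planar_map F u =
     (let y = F (vector [u $ 1, u $ 2, 1 - u $ 1 - u $ 2]) in vector [y $ 1, y $ 2])"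

definition planar_jacobian :: "(real^3 \<Rightarrow> real^3) \<Rightarrow> real^3 \<Rightarrow> real^2^2" where
  "planar_jacobian F x = jacobian (planar_map F) (at (vector [x $ 1, x $ 2]))"

lemma planar_map_V_differentiable: "planar_map (V \<alpha> \<beta> a b c d e) differentiable at u"
proof -
  have D: "(\<lambda>u::real^2. u $ i) differentiable at u" for i
    by (rule linear_imp_differentiable) (simp add: linear_iff)
  have "(\<lambda>u. planar_map (V \<alpha> \<beta> a b c d e) u $ i) differentiable at u" for i
    using exhaust_2[of i] by (auto simp: planar_map_def V_def intro!: derivative_intros D)
  then show ?thesis
    by (subst differentiable_componentwise_within)
       (auto simp: Basis_vec_def inner_axis)
qed

definition eigenvalues :: "real^'n^'n \<Rightarrow> complex set" where
  "eigenvalues A = {z. \<exists>v. v \<noteq> 0 \<and> map_matrix complex_of_real A *v v = z *s v}"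

definition fixed_point :: "(real^3 \<Rightarrow> real^3) \<Rightarrow> real^3 \<Rightarrow> bool" where
  "fixed_point F x \<longleftrightarrow> x \<in> simplex2 \<and> F x = x"

definition hyperbolic :: "(real^3 \<Rightarrow> real^3) \<Rightarrow> real^3 \<Rightarrow> bool" where
  "hyperbolic F x \<longleftrightarrow> fixed_point F x \<and> (\<forall>z\<in>eigenvalues (planar_jacobian F x). cmod z \<noteq> 1)"

definition nonhyperbolic :: "(real^3 \<Rightarrow> real^3) \<Rightarrow> real^3 \<Rightarrow> bool" where
  "nonhyperbolic F x \<longleftrightarrow> fixed_point F x \<and> \<not> hyperbolic F x"

definition attracting :: "(real^3 \<Rightarrow> real^3) \<Rightarrow> real^3 \<Rightarrow> bool" where
  "attracting F x \<longleftrightarrow> hyperbolic F x \<and> (\<forall>z\<in>eigenvalues (planar_jacobian F x). cmod z < 1)"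

definition repelling :: "(real^3 \<Rightarrow> real^3) \<Rightarrow> real^3 \<Rightarrow> bool" where
  "repelling F x \<longleftrightarrow> hyperbolic F x \<and> (\<forall>z\<in>eigenvalues (planar_jacobian F x). cmod z > 1)"

definition saddle :: "(real^3 \<Rightarrow> real^3) \<Rightarrow> real^3 \<Rightarrow> bool" where
  "saddle F x \<longleftrightarrow> hyperbolic F x \<and> \<not> attracting F x \<and> \<not> repelling F x"

end

theory Submission
  imports Defs
begin

text \<open>Put t = e x3, which lies in [0,1]. The planar Jacobian J has trace 2(t - 1) and
  determinant (t - 1)^2 - D, so completing the square in its characteristic polynomial gives the
  eigenvalues t - 1 +- sqrt D (\<open>eigenvalues_2\<close>, \<open>planar_jacobian_V\<close>). The
  classification then compares two moduli with 1. For D \<le> 0 the eigenvalues are conjugate, both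
  of modulus sqrt((1 - t)^2 - D), and the threshold is D = (1 - t)^2 - 1. For D \<ge> 0 they are
  real: t - 1 - sqrt D passes -1 when sqrt D = t, and t - 1 + sqrt D passes 1 when sqrt D = 2 -
  t.\<close>

text \<open>An eigenvector for z is a nonzero kernel vector of the complexified A - z I, and one
  exists exactly when that matrix is singular.\<close>

lemma eigenvalues_eq_det:
  fixes A :: "real^'n^'n"
  shows "eigenvalues A = {z. det (map_matrix complex_of_real A - mat z) = 0}"
proof -
  have "z \<in> eigenvalues A \<longleftrightarrow> det (map_matrix complex_of_real A - mat z) = 0" for z
  proof -
    let ?M = "map_matrix complex_of_real A - mat z"
    have mat_mult: "mat z *v v = z *s v" for v :: "complex^'n"
      by (simp add: vec_eq_iff matrix_vector_mult_def mat_def if_distrib [of "\<lambda>y. y * _"] cong: if_cong)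
    have ker: "map_matrix complex_of_real A *v v = z *s v \<longleftrightarrow> ?M *v v = 0" for v
      by (simp add: matrix_vector_mult_diff_rdistrib mat_mult)
    have "det ?M = 0 \<longleftrightarrow> \<not> invertible ?M"
      by (simp add: invertible_det_nz)
    also have "\<dots> \<longleftrightarrow> (\<exists>v. v \<noteq> 0 \<and> ?M *v v = 0)"
      by (auto simp: invertible_left_inverse matrix_left_invertible_ker)
    finally show ?thesis
      by (simp add: eigenvalues_def ker)
  qed
  then show ?thesis
    by blast
qed

text \<open>With half-trace m, the characteristic polynomial is (z - m)^2 - D. For D < 0 the
  principal root \<open>csqrt\<close> is i sqrt|D|, as the convention for sqrt D requires.\<close>

lemma eigenvalues_2:
  fixes A :: "real^2^2"
  assumes "A $ 1 $ 1 + A $ 2 $ 2 = 2 * m" and "D = m\<^sup>2 - det A"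
  shows "eigenvalues A = {of_real m + csqrt (of_real D), of_real m - csqrt (of_real D)}"
proof -
  have s: "A $ 2 $ 2 = 2 * m - A $ 1 $ 1"
    using assms(1) by simp
  have "det (map_matrix complex_of_real A - mat z) = (z - of_real m)\<^sup>2 - of_real D" for z
    unfolding assms(2)
    by (simp add: det_2 mat_def map_matrix_def s) (simp add: algebra_simps power2_eq_square)
  then have "det (map_matrix complex_of_real A - mat z) = (z - of_real m)\<^sup>2 - (csqrt (of_real D))\<^sup>2" for z
    by (simp only: power2_csqrt)
  then have "det (map_matrix complex_of_real A - mat z) = 0
      \<longleftrightarrow> z = of_real m + csqrt (of_real D) \<or> z = of_real m - csqrt (of_real D)" for z
    by (simp only: power2_eq_iff diff_eq_eq add_0_left add.commute [of _ "of_real m"] add_uminus_conv_diff)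
  then show ?thesis
    unfolding eigenvalues_eq_det by blast
qed

text \<open>By the chain rule for x3 = 1 - x1 - x2, the (i,j) entry is the j-th partial derivative
  of the i-th component of \<open>V\<close> minus its third one.\<close>

lemma planar_jacobian_V:
  assumes "x $ 1 + x $ 2 + x $ 3 = 1"
  shows "planar_jacobian (V \<alpha> \<beta> a b c d e) x = vector
    [vector [- 2 * c * x $ 3 - 2 * x $ 2, 2 * \<alpha> * x $ 2 - 2 * c * x $ 3 + 2 * x $ 3 - 2 * x $ 2],
     vector [2 * a * x $ 1 - 2 * d * x $ 3 + 2 * x $ 3 - 2 * x $ 1, - 2 * d * x $ 3 - 2 * x $ 1]]"
    (is "_ = ?J")
proof -
  let ?u = "vector [x $ 1, x $ 2] :: real^2"
  have x3: "x $ 3 = 1 - x $ 1 - x $ 2"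
    using assms by simp
  have "((\<lambda>u. planar_map (V \<alpha> \<beta> a b c d e) u $ i) has_derivative (\<lambda>h. (?J *v h) $ i)) (at ?u)" for i
    using exhaust_2[of i]
    by (auto simp: planar_map_def V_def matrix_vector_mult_def sum_2 x3 algebra_simps power2_eq_square
             intro!: derivative_eq_intros bounded_linear.has_derivative[OF bounded_linear_vec_nth] ext)
  then have "(planar_map (V \<alpha> \<beta> a b c d e) has_derivative (*v) ?J) (at ?u)"
    by (subst has_derivative_componentwise_within) (auto simp: Basis_vec_def inner_axis)
  then show ?thesis
    by (metis planar_jacobian_def jacobian_def frechet_derivative_at matrix_of_matrix_vector_mul)
qed

lemma cmod_csqrt_nonneg:
  assumes "D \<ge> 0"
  shows "cmod (of_real m + csqrt (of_real D)) = \<bar>m + sqrt D\<bar>"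
    and "cmod (of_real m - csqrt (of_real D)) = \<bar>m - sqrt D\<bar>"
  using assms by (simp_all flip: of_real_add of_real_diff add: csqrt_of_real_nonneg)

lemma cmod_csqrt_nonpos:
  assumes "D \<le> 0"
  shows "cmod (of_real m + csqrt (of_real D)) = sqrt (m\<^sup>2 - D)"
    and "cmod (of_real m - csqrt (of_real D)) = sqrt (m\<^sup>2 - D)"
  using assms by (simp_all add: csqrt_of_real_nonpos cmod_def)

theorem mainTheorem3:
  fixes \<alpha> \<beta> a b c d e D :: real and x :: "real^3" and F :: "real^3 \<Rightarrow> real^3"
  assumes "\<alpha> \<ge> 0" "\<beta> \<ge> 0" "a \<ge> 0" "b \<ge> 0" "c \<ge> 0" "d \<ge> 0" "e \<ge> 0"
    and "a + b = 1" "\<alpha> + \<beta> = 1" "c + d + e = 1"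
    and "F = V \<alpha> \<beta> a b c d e"
    and "fixed_point F x"
    and "D = (e * x $ 3 - 1)\<^sup>2 + 4 * e * (x $ 3)\<^sup>2
           + 4 * ((b * \<beta> - 1) * x $ 1 * x $ 2 + (a * (1 - c) - 1) * x $ 1 * x $ 3
                  + (\<alpha> * (1 - d) - 1) * x $ 2 * x $ 3)"
  shows "eigenvalues (planar_jacobian F x)
           = {of_real (e * x $ 3 - 1) + csqrt (of_real D),
              of_real (e * x $ 3 - 1) - csqrt (of_real D)}
    \<and> (D < - 1 + (1 - e * x $ 3)\<^sup>2 \<longrightarrow> repelling F x)
    \<and> (D = - 1 + (1 - e * x $ 3)\<^sup>2 \<longrightarrow> nonhyperbolic F x)
    \<and> (- 1 + (1 - e * x $ 3)\<^sup>2 < D \<and> D < 0 \<longrightarrow> attracting F x)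
    \<and> (D = 0 \<and> e * x $ 3 = 0 \<longrightarrow> nonhyperbolic F x)
    \<and> (D = 0 \<and> e * x $ 3 > 0 \<longrightarrow> attracting F x)
    \<and> (0 < D \<and> D < e\<^sup>2 * (x $ 3)\<^sup>2 \<longrightarrow> attracting F x)
    \<and> (D = e\<^sup>2 * (x $ 3)\<^sup>2 \<longrightarrow> nonhyperbolic F x)
    \<and> (e\<^sup>2 * (x $ 3)\<^sup>2 < D \<and> D < (2 - e * x $ 3)\<^sup>2 \<longrightarrow> saddle F x)
    \<and> (D = (2 - e * x $ 3)\<^sup>2 \<longrightarrow> nonhyperbolic F x)
    \<and> ((2 - e * x $ 3)\<^sup>2 < D \<longrightarrow> repelling F x)"
proof -
  define t where "t = e * x $ 3"
  have x_nonneg: "x $ 1 \<ge> 0" "x $ 2 \<ge> 0" "x $ 3 \<ge> 0" and x_sum: "x $ 1 + x $ 2 + x $ 3 = 1"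
    using assms(12) by (auto simp: fixed_point_def simplex2_def)
  \<comment> \<open>Both factors of t are at most 1: e because c + d + e = 1, and x3 because the
    coordinates sum to 1.\<close>
  have t: "0 \<le> t" "t \<le> 1"
    using assms(5-7,10) x_nonneg x_sum by (auto simp: t_def intro!: mult_le_one)
  have t_sq: "e\<^sup>2 * (x $ 3)\<^sup>2 = t\<^sup>2"
    by (simp add: t_def power_mult_distrib)
  \<comment> \<open>Eliminating these four quantities turns the trace and determinant claims into
    polynomial identities.\<close>
  have param: "a = 1 - b" "\<alpha> = 1 - \<beta>" "c = 1 - d - e" and x1: "x $ 1 = 1 - x $ 2 - x $ 3"
    using assms(8-10) x_sum by auto
  have eig: "eigenvalues (planar_jacobian F x) =
      {of_real (t - 1) + csqrt (of_real D), of_real (t - 1) - csqrt (of_real D)}"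
  proof (rule eigenvalues_2)
    show "planar_jacobian F x $ 1 $ 1 + planar_jacobian F x $ 2 $ 2 = 2 * (t - 1)"
      unfolding assms(11) planar_jacobian_V[OF x_sum] t_def
      by (simp add: param x1 algebra_simps)
    show "D = (t - 1)\<^sup>2 - det (planar_jacobian F x)"
      unfolding assms(11,13) planar_jacobian_V[OF x_sum] t_def
      by (simp add: det_2 param x1 power2_eq_square algebra_simps)
  qed
  define r s where "r = cmod (of_real (t - 1) + csqrt (of_real D))"
    and "s = cmod (of_real (t - 1) - csqrt (of_real D))"
  \<comment> \<open>With only two eigenvalues, a saddle has one modulus on each side of 1.\<close>
  have nonhyp: "nonhyperbolic F x \<longleftrightarrow> r = 1 \<or> s = 1"
    and attr: "attracting F x \<longleftrightarrow> r < 1 \<and> s < 1"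
    and rep: "repelling F x \<longleftrightarrow> r > 1 \<and> s > 1"
    and sad: "saddle F x \<longleftrightarrow> r < 1 \<and> s > 1 \<or> r > 1 \<and> s < 1"
    using assms(12)
    by (auto simp: nonhyperbolic_def attracting_def repelling_def saddle_def hyperbolic_def eig r_def s_def)
  have nonpos: "r = sqrt ((1 - t)\<^sup>2 - D)" "s = sqrt ((1 - t)\<^sup>2 - D)" if "D \<le> 0"
    unfolding r_def s_def cmod_csqrt_nonpos[OF that] by (simp_all add: power2_commute)
  have nonneg: "r = \<bar>t - 1 + sqrt D\<bar>" "s = \<bar>t - 1 - sqrt D\<bar>" if "D \<ge> 0"
    unfolding r_def s_def cmod_csqrt_nonneg[OF that] by simp_all
  \<comment> \<open>This places the first two cases in the range D \<le> 0, where
    \<open>nonpos\<close> applies.\<close>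
  have "(1 - t)\<^sup>2 \<le> 1"
    using t by (simp add: power_le_one)
  show ?thesis
    unfolding t_sq t_def[symmetric]
  proof (intro conjI impI eig)
    assume "D < - 1 + (1 - t)\<^sup>2"
    then show "repelling F x"
      using nonpos \<open>(1 - t)\<^sup>2 \<le> 1\<close> by (simp add: rep)
  next
    assume "D = - 1 + (1 - t)\<^sup>2"
    then show "nonhyperbolic F x"
      using nonpos \<open>(1 - t)\<^sup>2 \<le> 1\<close> by (simp add: nonhyp)
  next
    assume "- 1 + (1 - t)\<^sup>2 < D \<and> D < 0"
    then show "attracting F x"
      using nonpos by (simp add: attr)
  next
    \<comment> \<open>Here -1 is a double eigenvalue.\<close>
    assume "D = 0 \<and> t = 0"
    then show "nonhyperbolic F x"
      using nonneg by (simp add: nonhyp)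
  next
    assume "D = 0 \<and> t > 0"
    then show "attracting F x"
      using nonneg t by (simp add: attr)
  next
    assume D: "0 < D \<and> D < t\<^sup>2"
    then have "0 < sqrt D" "sqrt D < t"
      using t by (auto intro: real_less_lsqrt)
    then have "\<bar>t - 1 + sqrt D\<bar> < 1" "\<bar>t - 1 - sqrt D\<bar> < 1"
      using t by linarith+
    then show "attracting F x"
      using nonneg D by (simp add: attr)
  next
    \<comment> \<open>Now sqrt D = t, so t - 1 - sqrt D = -1.\<close>
    assume "D = t\<^sup>2"
    then show "nonhyperbolic F x"
      using nonneg t by (simp add: nonhyp)
  next
    \<comment> \<open>From t < sqrt D < 2 - t, s = 1 - t + sqrt D exceeds 1, while t - 1 + sqrt D
      stays strictly between -1 and 1.\<close>
    assume D: "t\<^sup>2 < D \<and> D < (2 - t)\<^sup>2"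
    then have "D \<ge> 0"
      by (meson less_imp_le order_trans zero_le_power2)
    moreover have "t < sqrt D" "sqrt D < 2 - t"
      using t D by (auto intro: real_less_rsqrt real_less_lsqrt)
    ultimately show "saddle F x"
      using nonneg t by (simp add: sad abs_less_iff)
  next
    \<comment> \<open>Now sqrt D = 2 - t, so t - 1 + sqrt D = 1.\<close>
    assume "D = (2 - t)\<^sup>2"
    then show "nonhyperbolic F x"
      using nonneg t by (simp add: nonhyp)
  next
    assume D: "(2 - t)\<^sup>2 < D"
    then have "D \<ge> 0"
      by (meson less_imp_le order_trans zero_le_power2)
    \<comment> \<open>This gives t - 1 + sqrt D > 1; as t \<le> 1, also 1 - t + sqrt D > 3 - 2t
      \<ge> 1.\<close>
    moreover have "2 - t < sqrt D"
      using D by (rule real_less_rsqrt)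
    ultimately show "repelling F x"
      using nonneg t by (simp add: rep)
  qed
qed

end
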